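(* Let $A$ be a real $n\times n$ matrix with $n>2$, let $\alpha\in(1/2,1]$, let $Z\in C^\alpha([0,T],\mathbb{R})$, and consider the linear Young differential equation in $\mathbb{R}^n$ $$dx_t=A\,x_t\,dZ_t ,$$ with linear solution flow $F_t=\exp\{A(Z_t-Z_0)\}$. Then there exists a pair of parallel foliations $\mathcal{F}(E_1)$, $\mathcal{F}(E_2)$ generated by complementary subspaces $E_1\oplus E_2=\mathbb{R}^n$ such that the decomposition $F_t=\eta_t\circ\psi_t$ of the flow according to these foliations exists for all $t\in[0,T]$, i.e. there is no explosion time of the decomposition. The dimension of $E_1$ can be chosen to be any number of the form $a+2b$, where $a\in\{0,1,\dots,r\}$, $r$ being the number of real eigenvalues of $A$ counted with multiplicity, and $b\in\{0,1,\dots,(n-r)/2\}$.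
   Context: For complementary subspaces $E_1\oplus E_2=\mathbb{R}^n$, $\mathcal{F}(E_i)$ denotes the foliation of $\mathbb{R}^n$ whose leaves are the affine translates $x+E_i$, $x\in\mathbb{R}^n$. The decomposition of $F_t$ according to $\mathcal{F}(E_1)$, $\mathcal{F}(E_2)$ is $F_t=\eta_t\circ\psi_t$ with $\eta_t$, $\psi_t$ diffeomorphisms such that $\eta_t$ maps each leaf of $\mathcal{F}(E_1)$ to itself and $\psi_t$ maps each leaf of $\mathcal{F}(E_2)$ to itself. In general such a decomposition exists only up to a lifetime. Integrals with respect to $Z$ are Young (Riemann–Stieltjes) integrals. *)

theory Defs
  imports "HOL-Analysis.Analysis" "HOL-Computational_Algebra.Polynomial"
begin

section \<open>Real eigenvalues counted with multiplicity\<close>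

definition real_eigenvalues :: "real^'n^'n \<Rightarrow> real set" where
  "real_eigenvalues A = {\<mu>. \<exists>v. v \<noteq> 0 \<and> A *v v = \<mu> *\<^sub>R v}"

definition charpoly :: "real^'n^'n \<Rightarrow> real poly" where
  "charpoly A = det (\<chi> i j. (if i = j then [:0, 1:] else 0) - [:A $ i $ j:])"

text \<open>Multiplicity is algebraic multiplicity, i.e. the order as a root of the characteristic
  polynomial.\<close>

definition num_real_eigenvalues :: "real^'n^'n \<Rightarrow> nat" where
  "num_real_eigenvalues A = (\<Sum>\<mu>\<in>real_eigenvalues A. order \<mu> (charpoly A))"

section \<open>The matrix exponential\<close>

text \<open>The library multiplication and power on the type \<^typ>\<open>real^'n^'n\<close> are componentwise,
  and the type is not an instance of the class on which \<^const>\<open>exp\<close> is defined.\<close>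

primrec matpow :: "real^'n^'n \<Rightarrow> nat \<Rightarrow> real^'n^'n" where
  "matpow A 0 = mat 1"
| "matpow A (Suc k) = A ** matpow A k"

definition mexp :: "real^'n^'n \<Rightarrow> real^'n^'n" where
  "mexp A = (\<Sum>k. matpow A k /\<^sub>R fact k)"

section \<open>Linear Young differential equations\<close>

definition holder_on :: "real \<Rightarrow> real set \<Rightarrow> (real \<Rightarrow> 'a::metric_space) \<Rightarrow> bool" where
  "holder_on \<alpha> S f \<longleftrightarrow> (\<exists>C. \<forall>s\<in>S. \<forall>t\<in>S. dist (f s) (f t) \<le> C * \<bar>s - t\<bar> powr \<alpha>)"

text \<open>The integral is the limit of Riemann--Stieltjes sums with arbitrary tags as the mesh tends
  to zero: the gauge is a ball of constant radius \<open>\<delta>\<close>, in contrast to the variable gauges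
  of the Henstock--Kurzweil integral.\<close>

definition has_young_integral ::
    "(real \<Rightarrow> 'a::real_normed_vector) \<Rightarrow> (real \<Rightarrow> real) \<Rightarrow> real \<Rightarrow> real \<Rightarrow> 'a \<Rightarrow> bool" where
  "has_young_integral f Z a b I \<longleftrightarrow>
     (\<forall>\<epsilon>>0. \<exists>\<delta>>0. \<forall>p. p tagged_division_of {a..b} \<and> (\<lambda>x. ball x \<delta>) fine p \<longrightarrow>
        norm ((\<Sum>(x, k)\<in>p. (Z (Sup k) - Z (Inf k)) *\<^sub>R f x) - I) < \<epsilon>)"

definition linear_young_solution ::
    "real^'n^'n \<Rightarrow> real \<Rightarrow> real \<Rightarrow> (real \<Rightarrow> real) \<Rightarrow> real^'n \<Rightarrow> (real \<Rightarrow> real^'n) \<Rightarrow> bool" where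
  "linear_young_solution A \<alpha> T Z x\<^sub>0 x \<longleftrightarrow>
     holder_on \<alpha> {0..T} x \<and> x 0 = x\<^sub>0 \<and>
     (\<forall>t\<in>{0..T}. has_young_integral (\<lambda>s. A *v x s) Z 0 t (x t - x\<^sub>0))"

definition linear_young_flow :: "real^'n^'n \<Rightarrow> (real \<Rightarrow> real) \<Rightarrow> real \<Rightarrow> real^'n \<Rightarrow> real^'n" where
  "linear_young_flow A Z t = (\<lambda>x. mexp ((Z t - Z 0) *\<^sub>R A) *v x)"

section \<open>Diffeomorphisms and parallel foliations\<close>

text \<open>In finite dimension, a map is $C^{k+1}$ iff it is differentiable and each of its directional
  derivatives is $C^k$.\<close>

primrec Ck :: "nat \<Rightarrow> ('a::euclidean_space \<Rightarrow> 'b::euclidean_space) \<Rightarrow> bool" where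
  "Ck 0 f \<longleftrightarrow> continuous_on UNIV f"
| "Ck (Suc k) f \<longleftrightarrow> (\<forall>x. f differentiable (at x)) \<and> (\<forall>v. Ck k (\<lambda>x. frechet_derivative f (at x) v))"

definition smooth :: "('a::euclidean_space \<Rightarrow> 'b::euclidean_space) \<Rightarrow> bool" where
  "smooth f \<longleftrightarrow> (\<forall>k. Ck k f)"

definition diffeomorphism :: "('a::euclidean_space \<Rightarrow> 'a) \<Rightarrow> bool" where
  "diffeomorphism f \<longleftrightarrow> bij f \<and> smooth f \<and> smooth (inv f)"

definition complementary_subspaces :: "'a::euclidean_space set \<Rightarrow> 'a set \<Rightarrow> bool" where
  "complementary_subspaces E\<^sub>1 E\<^sub>2 \<longleftrightarrow>
     subspace E\<^sub>1 \<and> subspace E\<^sub>2 \<and> E\<^sub>1 \<inter> E\<^sub>2 = {0} \<and> {x + y |x y. x \<in> E\<^sub>1 \<and> y \<in> E\<^sub>2} = UNIV"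

definition parallel_foliation :: "'a::euclidean_space set \<Rightarrow> 'a set set" where
  "parallel_foliation E = {(+) x ` E |x. True}"

definition leaf_preserving :: "'a set set \<Rightarrow> ('a \<Rightarrow> 'a) \<Rightarrow> bool" where
  "leaf_preserving \<F> f \<longleftrightarrow> (\<forall>L\<in>\<F>. f ` L = L)"

definition foliation_decomposition ::
    "'a::euclidean_space set \<Rightarrow> 'a set \<Rightarrow> ('a \<Rightarrow> 'a) \<Rightarrow> ('a \<Rightarrow> 'a) \<Rightarrow> ('a \<Rightarrow> 'a) \<Rightarrow> bool" where
  "foliation_decomposition E\<^sub>1 E\<^sub>2 F \<eta> \<psi> \<longleftrightarrow>
     diffeomorphism \<eta> \<and> leaf_preserving (parallel_foliation E\<^sub>1) \<eta> \<and>
     diffeomorphism \<psi> \<and> leaf_preserving (parallel_foliation E\<^sub>2) \<psi> \<and>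
     F = \<eta> \<circ> \<psi>"

end

theory Submission
  imports Defs "HOL-Computational_Algebra.Fundamental_Theorem_Algebra"
begin

text \<open>
  The flow \<open>F\<^sub>t = e^{(Z\<^sub>t - Z\<^sub>0) A}\<close> is a linear isomorphism which maps every \<open>A\<close>-invariant
  subspace onto itself. Take \<open>E\<^sub>1\<close> invariant and \<open>E\<^sub>2\<close> any complement. With respect to
  \<open>E\<^sub>1 \<oplus> E\<^sub>2\<close> the flow is block upper triangular, and
  \<open>(F11 F12; 0 F22) = (F11 F12 F22^{-1}; 0 1) (1 0; 0 F22)\<close>, where the left factor moves points
  along \<open>E\<^sub>1\<close> and the right factor along \<open>E\<^sub>2\<close>. In general the decomposition explodes when the
  block \<open>F22\<close> becomes singular; for a block triangular isomorphism this cannot happen, so the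
  decomposition exists for all times (\<open>foliation_decomposition_linear\<close>).

  It remains to find invariant subspaces of dimension \<open>a + 2 b\<close>. If \<open>A\<close> has a real
  eigenvalue, there are invariant subspaces of every dimension (\<open>invariant_subspace_any_dim\<close>);
  if not, there are invariant subspaces of every even dimension
  (\<open>invariant_subspace_even_dim\<close>), and then \<open>a = 0\<close>. Both facts rest on the step from an
  invariant subspace to a larger one by adding one or two dimensions, which is possible because a
  real polynomial has factors of degree at most 2; the first one also uses an invariant hyperplane.
  Multiplicities of eigenvalues enter through the bound of \<open>a + 2 b\<close> by the dimension of the
  space.

  That the flow solves the equation is the chain rule for Young integrals
  (\<open>has_young_integral_chain_rule\<close>), applied to the orbit \<open>z \<mapsto> e^{(z - Z\<^sub>0) A} x\<close>, whose
  derivative is \<open>A\<close> times itself.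
\<close>

section \<open>Real polynomials acting through a linear map\<close>

text \<open>A complex root \<open>z\<close> is either real, which gives a linear factor, or comes with its conjugate, so
  that \<open>g = (X - z) (X - cnj z)\<close> has real coefficients. In the second case the remainder of
  \<open>p\<close> modulo \<open>g\<close> is a real polynomial of degree at most 1 with the non-real root
  \<open>z\<close>, hence zero.\<close>

lemma real_poly_split_off_low_degree:
  fixes p :: "real poly"
  assumes "degree p > 0"
  obtains g h where "p = g * h" "degree g = 1 \<or> degree g = 2"
proof -
  define P where "P = (map_poly of_real :: real poly \<Rightarrow> complex poly)"
  have P_coeff: "coeff (P q) i = of_real (coeff q i)" for q i
    by (simp add: P_def coeff_map_poly)
  have P_add: "P (q + q') = P q + P q'" and P_mult: "P (q * q') = P q * P q'" for q q'
    by (auto intro!: poly_eqI simp: P_coeff coeff_mult)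
  have P_pCons: "P (pCons a q) = pCons (of_real a) (P q)" for a q
    by (simp add: P_def map_poly_pCons)
  have P_0: "P 0 = 0" by (simp add: P_def)
  have "degree (P p) = degree p"
    by (simp add: P_def degree_map_poly)
  then obtain z where z: "poly (P p) z = 0"
    using assms fundamental_theorem_of_algebra[of "P p"] by (auto simp: constant_degree)
  show thesis
  proof (cases "Im z = 0")
    case True
    have "poly (P q) (of_real x) = of_real (poly q x)" for q x
      by (induction q) (simp_all add: P_0 P_pCons)
    from this[of p "Re z"] have "poly p (Re z) = 0"
      using True z by (simp add: complex_is_Real_iff of_real_Re)
    then obtain h where "p = [:- Re z, 1:] * h"
      by (auto simp: poly_eq_0_iff_dvd)
    then show thesis by (intro that[of "[:- Re z, 1:]" h]) auto
  next
    case False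
    define g where "g = [:(Re z)\<^sup>2 + (Im z)\<^sup>2, - 2 * Re z, 1:]"
    have dg: "degree g = 2" by (simp add: g_def)
    have g0: "poly (P g) z = 0"
      by (simp add: g_def P_pCons P_0 complex_eq_iff power2_eq_square algebra_simps)
    obtain c d where cd: "p mod g = [:c, d:]"
    proof -
      have "degree (p mod g) < 2"
        using degree_mod_less[of g p] dg by (metis degree_0 zero_neq_numeral pos2)
      then have "p mod g = [:coeff (p mod g) 0, coeff (p mod g) 1:]"
        by (intro poly_eqI) (auto simp: coeff_pCons coeff_eq_0 split: nat.splits)
      then show thesis by (rule that)
    qed
    have "P p = P g * P (p div g) + P (p mod g)"
      by (metis P_add P_mult mult_div_mod_eq)
    with z g0 have "poly (P (p mod g)) z = 0" by simp
    then have "c + d * z = 0" by (simp add: cd P_pCons P_0 mult.commute)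
    then have "c = 0 \<and> d = 0" using False by (auto simp: complex_eq_iff)
    then have "p = g * (p div g)" using cd by (metis mult_div_mod_eq add.right_neutral pCons_0_0)
    then show thesis using dg that by blast
  qed
qed

text \<open>This is \<open>p(f) v\<close>, evaluated by Horner's scheme, so that no powers of the operator \<open>f\<close>
  have to be formed.\<close>

definition poly_act :: "('a::real_vector \<Rightarrow> 'a) \<Rightarrow> real poly \<Rightarrow> 'a \<Rightarrow> 'a" where
  "poly_act f p v = fold_coeffs (\<lambda>a w. a *\<^sub>R v + f w) p 0"

lemma poly_act_0 [simp]: "poly_act f 0 v = 0"
  by (simp add: poly_act_def)

lemma poly_act_pCons [simp]:
  assumes "linear f"
  shows "poly_act f (pCons a p) v = a *\<^sub>R v + f (poly_act f p v)"
  by (cases "p = 0"; cases "a = 0") (simp_all add: poly_act_def linear_0[OF assms])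

lemma poly_act_add:
  assumes "linear f"
  shows "poly_act f (p + q) v = poly_act f p v + poly_act f q v"
  by (induction p q rule: poly_induct2) (simp_all add: assms linear_add algebra_simps)

lemma poly_act_smult:
  assumes "linear f"
  shows "poly_act f (smult c p) v = c *\<^sub>R poly_act f p v"
  by (induction p) (simp_all add: assms linear_cmul algebra_simps)

lemma poly_act_mult:
  assumes "linear f"
  shows "poly_act f (p * q) v = poly_act f p (poly_act f q v)"
  by (induction p) (simp_all add: assms poly_act_add poly_act_smult)

definition invariant :: "('a::real_vector \<Rightarrow> 'a) \<Rightarrow> 'a set \<Rightarrow> bool" where
  "invariant f W \<longleftrightarrow> subspace W \<and> f ` W \<subseteq> W"

lemma poly_act_in_invariant:
  assumes "linear f" "invariant f V" "v \<in> V"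
  shows "poly_act f p v \<in> V"
  using assms by (induction p)
    (auto simp: invariant_def image_subset_iff subspace_0 intro!: subspace_add subspace_scale)

text \<open>Otherwise the subspaces \<open>W + {p(f) v | deg p < k}\<close> would increase strictly with \<open>k\<close>,
  which finite dimension forbids. For \<open>W = 0\<close> this is the existence of a minimal polynomial of
  \<open>f\<close> at \<open>v\<close>; in general it is that of the class of \<open>v\<close> modulo \<open>W\<close>.\<close>

lemma poly_act_eventually_in_subspace:
  fixes f :: "'a::euclidean_space \<Rightarrow> 'a"
  assumes f: "linear f" and W: "subspace W"
  shows "\<exists>p. p \<noteq> 0 \<and> poly_act f p v \<in> W"
proof (rule ccontr)
  assume neg: "\<not> ?thesis"
  define Q where "Q k = {w + poly_act f p v | w p. w \<in> W \<and> (\<forall>i\<ge>k. coeff p i = 0)}" for k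
  have sub: "subspace (Q k)" for k
    unfolding subspace_def
  proof (intro conjI ballI allI)
    show "0 \<in> Q k"
      unfolding Q_def using subspace_0[OF W] by (auto intro!: exI[of _ 0])
  next
    fix x y assume "x \<in> Q k" "y \<in> Q k"
    then obtain w p w' p' where "x = w + poly_act f p v" "y = w' + poly_act f p' v"
      "w \<in> W" "w' \<in> W" "\<forall>i\<ge>k. coeff p i = 0" "\<forall>i\<ge>k. coeff p' i = 0"
      unfolding Q_def by blast
    then show "x + y \<in> Q k"
      unfolding Q_def
      by (auto intro!: exI[of _ "w + w'"] exI[of _ "p + p'"] simp: poly_act_add[OF f] subspace_add[OF W])
  next
    fix c x assume "x \<in> Q k"
    then obtain w p where "x = w + poly_act f p v" "w \<in> W" "\<forall>i\<ge>k. coeff p i = 0"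
      unfolding Q_def by blast
    then show "c *\<^sub>R x \<in> Q k"
      unfolding Q_def
      by (auto intro!: exI[of _ "c *\<^sub>R w"] exI[of _ "smult c p"]
          simp: poly_act_smult[OF f] subspace_scale[OF W] scaleR_add_right)
  qed
  have "k \<le> dim (Q k)" for k
  proof (induction k)
    case (Suc k)
    have le: "Q k \<subseteq> Q (Suc k)" unfolding Q_def by fastforce
    let ?x = "poly_act f (monom 1 k) v"
    have "?x \<in> Q (Suc k)"
      unfolding Q_def using subspace_0[OF W] by (auto intro!: exI[of _ 0] exI[of _ "monom 1 k"])
    moreover have "?x \<notin> Q k"
    proof
      assume "?x \<in> Q k"
      then obtain w p where wp: "?x = w + poly_act f p v" "w \<in> W" "\<forall>i\<ge>k. coeff p i = 0"
        unfolding Q_def by blast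
      let ?q = "monom 1 k + smult (-1) p"
      have "poly_act f ?q v = w"
        unfolding poly_act_add[OF f] poly_act_smult[OF f] wp(1) by simp
      moreover have "coeff ?q k = 1" using wp(3) by simp
      then have "?q \<noteq> 0" by (metis coeff_0 zero_neq_one)
      ultimately show False using neg wp(2) by blast
    qed
    ultimately have "Q k \<subset> Q (Suc k)" using le by blast
    then have "dim (Q k) < dim (Q (Suc k))"
      by (intro dim_psubset) (metis sub span_eq_iff)
    then show ?case using Suc by simp
  qed simp
  from this[of "Suc DIM('a)"] show False
    using dim_subset_UNIV[of "Q (Suc DIM('a))"] by simp
qed

section \<open>Dimensions of invariant subspaces\<close>

lemma invariant_span:
  assumes "linear f" "f ` S \<subseteq> span S"
  shows "invariant f (span S)"
  unfolding invariant_def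
  using linear_span_image[OF assms(1), of S] span_minimal[OF assms(2) subspace_span] by simp

text \<open>This says that a nonzero quotient \<open>V / W\<close> contains an invariant subspace of dimension 1 or 2,
  phrased without quotients. If \<open>p = g h\<close> is the minimal polynomial of \<open>v \<in> V - W\<close> modulo
  \<open>W\<close> and \<open>g\<close> has degree 1 or 2, then \<open>u = h(f) v\<close> is not in \<open>W\<close> but is
  annihilated by \<open>g(f)\<close> modulo \<open>W\<close>; therefore \<open>W\<close>, \<open>u\<close> and \<open>f u\<close> span an
  invariant subspace.\<close>

lemma invariant_subspace_extend_by_at_most_2:
  fixes f :: "'a::euclidean_space \<Rightarrow> 'a"
  assumes f: "linear f" and W: "invariant f W" and V: "invariant f V" and WV: "W \<subset> V"
  obtains W' where "invariant f W'" "W \<subset> W'" "W' \<subseteq> V" "dim W' \<le> dim W + 2"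
proof -
  have sW: "subspace W" and sV: "subspace V" using W V by (auto simp: invariant_def)
  obtain v where v: "v \<in> V" "v \<notin> W" using WV by blast
  obtain p where p: "p \<noteq> 0" "poly_act f p v \<in> W"
    and min: "\<And>q. q \<noteq> 0 \<and> poly_act f q v \<in> W \<Longrightarrow> degree p \<le> degree q"
    using exists_least_iff[of "\<lambda>n. \<exists>q. q \<noteq> 0 \<and> poly_act f q v \<in> W \<and> degree q = n"]
      poly_act_eventually_in_subspace[OF f sW, of v] by (metis linorder_not_less)
  (* A nonzero constant polynomial would put v itself into W. *)
  have "degree p > 0"
  proof (rule ccontr)
    assume "\<not> ?thesis"
    then obtain c where "p = [:c:]" by (auto elim: degree_eq_zeroE)
    then have "c \<noteq> 0" "c *\<^sub>R v \<in> W" using p by (auto simp: f linear_0)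
    then show False using v(2) subspace_scale[OF sW, of "c *\<^sub>R v" "1 / c"] by simp
  qed
  then obtain g h where gh: "p = g * h" and dg: "degree g = 1 \<or> degree g = 2"
    by (rule real_poly_split_off_low_degree)
  define u where "u = poly_act f h v"
  have "h \<noteq> 0" "g \<noteq> 0" using gh p(1) by auto
  then have "degree h < degree p" using gh dg by (auto simp: degree_mult_eq)
  then have uW: "u \<notin> W" using min[of h] \<open>h \<noteq> 0\<close> unfolding u_def by linarith
  have uV: "u \<in> V" unfolding u_def by (rule poly_act_in_invariant[OF f V v(1)])
  have gu: "poly_act f g u \<in> W" using p(2) by (simp add: u_def gh poly_act_mult[OF f])
  let ?S = "insert u (insert (f u) W)"
  have S: "x \<in> ?S \<Longrightarrow> x \<in> span ?S" for x by (rule span_base)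
  have scale: "x \<in> span ?S" if "c \<noteq> 0" "c *\<^sub>R x \<in> span ?S" for c x
    using span_scale[OF that(2), of "1 / c"] that(1) by simp
  have "f (f u) \<in> span ?S"
    using dg
  proof
    assume "degree g = 1"
    then obtain c d where g: "g = [:c, d:]" "d \<noteq> 0" by (metis One_nat_def degree1_coeffs)
    have "f (poly_act f g u) \<in> W" using gu W by (auto simp: invariant_def)
    then have "c *\<^sub>R f u + d *\<^sub>R f (f u) \<in> span ?S"
      by (intro S) (simp add: g f linear_0 linear_add linear_cmul)
    then have "d *\<^sub>R f (f u) \<in> span ?S"
      using span_add_eq[of "c *\<^sub>R f u" ?S] S[of "f u"] span_scale by blast
    then show ?thesis using scale g(2) by blast
  next
    assume "degree g = 2"
    then obtain c d e where g: "g = [:c, d, e:]" "e \<noteq> 0" by (metis degree2_coeffs)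
    have "c *\<^sub>R u + (d *\<^sub>R f u + e *\<^sub>R f (f u)) \<in> span ?S"
      using gu by (intro S) (simp add: g f linear_0 linear_add linear_cmul)
    then have "d *\<^sub>R f u + e *\<^sub>R f (f u) \<in> span ?S"
      using span_add_eq[of "c *\<^sub>R u" ?S] S[of u] span_scale by blast
    then have "e *\<^sub>R f (f u) \<in> span ?S"
      using span_add_eq[of "d *\<^sub>R f u" ?S] S[of "f u"] span_scale by blast
    then show ?thesis using scale g(2) by blast
  qed
  then have "f ` ?S \<subseteq> span ?S" using W S by (auto simp: invariant_def)
  then have "invariant f (span ?S)" by (rule invariant_span[OF f])
  moreover have "W \<subset> span ?S" using uW S by auto
  moreover have "span ?S \<subseteq> V"
    using uV WV V by (intro span_minimal sV) (auto simp: invariant_def)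
  moreover have "dim (span ?S) \<le> dim W + 2" by (simp add: dim_insert)
  ultimately show thesis by (rule that)
qed

definition has_real_eigenvector :: "('a::real_vector \<Rightarrow> 'a) \<Rightarrow> 'a set \<Rightarrow> bool" where
  "has_real_eigenvector f V \<longleftrightarrow> (\<exists>v\<in>V. v \<noteq> 0 \<and> (\<exists>\<mu>. f v = \<mu> *\<^sub>R v))"

text \<open>On the one-dimensional quotient \<open>W' / W\<close> the map is multiplication by some \<open>\<mu>\<close>, hence
  \<open>f - \<mu>\<close> maps \<open>W'\<close> into the smaller space \<open>W\<close> and has a kernel in \<open>W'\<close>. The
  eigenvalue seen on the quotient is thus attained by a genuine eigenvector.\<close>

lemma invariant_codim_1_has_real_eigenvector:
  fixes f :: "'a::euclidean_space \<Rightarrow> 'a"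
  assumes f: "linear f" and W: "invariant f W" and W': "invariant f W'"
    and WW': "W \<subset> W'" and d: "dim W' = dim W + 1"
  shows "has_real_eigenvector f W'"
proof -
  have sW: "subspace W" and sW': "subspace W'" using W W' by (auto simp: invariant_def)
  obtain u where u: "u \<in> W'" "u \<notin> W" using WW' by blast
  have su: "span (insert u W) = W'"
  proof (rule subspace_dim_equal)
    show "span (insert u W) \<subseteq> W'" using u WW' sW' by (intro span_minimal) auto
    show "dim W' \<le> dim (span (insert u W))"
      using u d by (simp add: dim_insert span_eq_iff[THEN iffD2, OF sW])
  qed (auto simp: sW')
  have "f u \<in> span (insert u W)" using u W' by (auto simp: su invariant_def)
  then obtain \<mu> where mu: "f u - \<mu> *\<^sub>R u \<in> W"
    using sW by (metis span_breakdown_eq span_eq_iff)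
  define N where "N x = f x - \<mu> *\<^sub>R x" for x
  have N: "linear N" unfolding N_def
    by (intro linear_compose_sub f linear_scale_self)
  have "N ` W' \<subseteq> W"
  proof -
    have "N ` W' = span (N ` insert u W)" using linear_span_image[OF N] su by metis
    also have "\<dots> \<subseteq> W"
      using mu W sW by (intro span_minimal)
        (auto simp: N_def invariant_def intro!: subspace_diff subspace_scale)
    finally show ?thesis .
  qed
  then have "dim (N ` W') \<le> dim W" by (rule dim_subset)
  then have "\<not> inj_on N (span W')"
    using d dim_image_eq[OF N, of W'] by force
  then have "\<not> inj_on N W'" using sW' by (metis span_eq_iff)
  then obtain x where "x \<in> W'" "N x = 0" "x \<noteq> 0"
    using linear_inj_on_iff_eq_0[OF N sW'] by blast
  then show ?thesis unfolding has_real_eigenvector_def N_def by auto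
qed

text \<open>Starting from 0, invariant subspaces can be enlarged by 1 or 2 dimensions at a time. Without a
  real eigenvector a step of size 1 never happens, so every even dimension is met.\<close>

lemma invariant_subspace_even_dim:
  fixes f :: "'a::euclidean_space \<Rightarrow> 'a"
  assumes f: "linear f" and V: "invariant f V" and no: "\<not> has_real_eigenvector f V"
  shows "2 * j \<le> dim V \<Longrightarrow> \<exists>W. invariant f W \<and> W \<subseteq> V \<and> dim W = 2 * j"
proof (induction j)
  case 0
  then show ?case using V
    by (intro exI[of _ "{0}"]) (auto simp: invariant_def linear_0[OF f] subspace_0)
next
  case (Suc j)
  then obtain W where W: "invariant f W" "W \<subseteq> V" "dim W = 2 * j" by auto
  have "W \<subset> V" using W Suc.prems by auto
  then obtain W' where W': "invariant f W'" "W \<subset> W'" "W' \<subseteq> V" "dim W' \<le> dim W + 2"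
    using invariant_subspace_extend_by_at_most_2[OF f W(1) V] by blast
  have "dim W < dim W'"
    using W(1) W'(1,2) by (intro dim_psubset) (metis span_eq_iff invariant_def)
  moreover have "dim W' \<noteq> dim W + 1"
    using invariant_codim_1_has_real_eigenvector[OF f W(1) W'(1,2)] no W'(3)
    unfolding has_real_eigenvector_def by blast
  ultimately have "dim W' = 2 * Suc j" using W'(4) W(3) by simp
  then show ?case using W' by blast
qed

text \<open>Every subspace between the range of \<open>f - \<mu>\<close> on \<open>V\<close> and \<open>V\<close> is invariant, and the
  range is a proper subspace when \<open>\<mu>\<close> is an eigenvalue on \<open>V\<close>. A hyperplane that contains
  the range is obtained from a normal vector \<open>w\<close>.\<close>

lemma invariant_hyperplane:
  fixes f :: "'a::euclidean_space \<Rightarrow> 'a"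
  assumes f: "linear f" and V: "invariant f V" and ev: "has_real_eigenvector f V"
  obtains H where "invariant f H" "H \<subseteq> V" "dim V = Suc (dim H)"
proof -
  have sV: "subspace V" using V by (auto simp: invariant_def)
  obtain v \<mu> where v: "v \<in> V" "v \<noteq> 0" "f v = \<mu> *\<^sub>R v"
    using ev by (auto simp: has_real_eigenvector_def)
  define N where "N x = f x - \<mu> *\<^sub>R x" for x
  have N: "linear N" unfolding N_def
    by (intro linear_compose_sub f linear_scale_self)
  have NV: "N ` V \<subseteq> V" using V
    by (auto simp: N_def invariant_def intro!: subspace_diff subspace_scale)
  have sNV: "subspace (N ` V)" by (rule linear_subspace_image[OF N sV])
  have "\<not> inj_on N V"
    using v linear_inj_on_iff_eq_0[OF N sV] by (auto simp: N_def)
  (* A surjective linear self-map of a finite-dimensional space is injective: it maps a basis to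
     a spanning set of the same size, that is, to a basis. *)
  have "N ` V \<noteq> V"
  proof
    assume eq: "N ` V = V"
    obtain B where B: "B \<subseteq> V" "independent B" "V \<subseteq> span B" "card B = dim V"
      using basis_exists[of V] by metis
    then have "finite B" by (auto simp: finiteI_independent)
    have sB: "span B = V" using B sV by (metis span_minimal subset_antisym)
    have "V \<subseteq> span (N ` B)" using eq sB linear_span_image[OF N, of B] by simp
    then have "dim V \<le> card (N ` B)"
      using \<open>finite B\<close> by (intro dim_le_card) auto
    then have "card (N ` B) = card B" using B(4) card_image_le[OF \<open>finite B\<close>, of N] by simp
    then have "inj_on N B" using \<open>finite B\<close> by (simp add: eq_card_imp_inj_on)
    moreover have "independent (N ` B)"
      using \<open>V \<subseteq> span (N ` B)\<close> \<open>card (N ` B) = card B\<close> B(1,4) NV \<open>finite B\<close>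
      by (intro card_le_dim_spanning[of _ V]) auto
    ultimately have "inj_on N (span B)"
      using N by (metis linear_inj_on_span_iff_independent_image)
    then show False using sB \<open>\<not> inj_on N V\<close> by simp
  qed
  then have "span (N ` V) \<subset> span V" using NV sNV sV by (metis psubsetI span_eq_iff)
  then obtain w where w: "w \<noteq> 0" "w \<in> span V" "\<And>y. y \<in> span (N ` V) \<Longrightarrow> orthogonal w y"
    by (rule orthogonal_to_subspace_exists_gen) blast
  define H where "H = {y \<in> V. orthogonal w y}"
  have "H = {y \<in> V. \<forall>x\<in>span {w}. orthogonal x y}"
    unfolding H_def by (auto simp: span_base span_singleton orthogonal_def)
  then have "dim H + dim (span {w}) = dim V"
    using dim_subspace_orthogonal_to_vectors[of "span {w}" V] w(2) sV
    by (simp add: span_minimal span_eq_iff[THEN iffD2, OF sV])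
  then have "dim V = Suc (dim H)" using w(1) by (simp add: dim_insert)
  moreover have "subspace H"
    using sV by (auto simp: H_def subspace_def orthogonal_def inner_add_right)
  moreover have "f x \<in> H" if x: "x \<in> H" for x
  proof -
    have "orthogonal w (N x)" using x w(3) by (auto simp: H_def span_base)
    then have "orthogonal w (f x)" using x by (auto simp: H_def N_def orthogonal_def inner_diff_right)
    then show ?thesis using x V by (auto simp: H_def invariant_def)
  qed
  ultimately show thesis by (intro that[of H]) (auto simp: invariant_def H_def)
qed

text \<open>Induction on \<open>dim V\<close>, through an invariant hyperplane \<open>H\<close>. If \<open>H\<close> still has a real
  eigenvector, the induction hypothesis yields all dimensions up to \<open>dim H\<close>. Otherwise \<open>H\<close>
  has invariant subspaces of every even dimension, and the eigenvector of \<open>V\<close>, lying outside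
  \<open>H\<close>, raises each of them by one to an odd dimension.\<close>

lemma invariant_subspace_any_dim:
  fixes f :: "'a::euclidean_space \<Rightarrow> 'a"
  assumes f: "linear f" and V: "invariant f V" and ev: "has_real_eigenvector f V"
    and k: "k \<le> dim V"
  shows "\<exists>W. invariant f W \<and> W \<subseteq> V \<and> dim W = k"
  using V ev k
proof (induction "dim V" arbitrary: V k rule: less_induct)
  case less
  show ?case
  proof (cases "k = dim V")
    case True
    then show ?thesis using less by blast
  next
    case False
    obtain H where H: "invariant f H" "H \<subseteq> V" "dim V = Suc (dim H)"
      using invariant_hyperplane[OF f less.prems(1,2)] .
    have kH: "k \<le> dim H" using less.prems(3) False H by simp
    show ?thesis
    proof (cases "has_real_eigenvector f H")
      case True
      then show ?thesis using less.hyps[of H k] H kH by fastforce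
    next
      case noH: False
      show ?thesis
      proof (cases "even k")
        case True
        then show ?thesis
          using invariant_subspace_even_dim[OF f H(1) noH, of "k div 2"] kH H(2) by auto
      next
        case False
        then have k: "k = 2 * (k div 2) + 1" by presburger
        obtain W where W: "invariant f W" "W \<subseteq> H" "dim W = 2 * (k div 2)"
          using invariant_subspace_even_dim[OF f H(1) noH, of "k div 2"] kH k by auto
        obtain v \<mu> where v: "v \<in> V" "v \<noteq> 0" "f v = \<mu> *\<^sub>R v"
          using less.prems(2) by (auto simp: has_real_eigenvector_def)
        have "v \<notin> W" using noH v W(2) by (auto simp: has_real_eigenvector_def)
        then have "v \<notin> span W" using W(1) by (metis invariant_def span_eq_iff)
        then have "dim (span (insert v W)) = k" using W(3) k by (simp add: dim_insert)
        moreover have "invariant f (span (insert v W))"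
        proof (rule invariant_span[OF f])
          have "\<mu> *\<^sub>R v \<in> span (insert v W)" by (simp add: span_base span_scale)
          moreover have "f x \<in> span (insert v W)" if "x \<in> W" for x
            using W(1) that by (intro span_base) (auto simp: invariant_def)
          ultimately show "f ` insert v W \<subseteq> span (insert v W)" by (auto simp: v(3))
        qed
        moreover have "span (insert v W) \<subseteq> V"
          using v W(2) H(2) less.prems(1) by (intro span_minimal) (auto simp: invariant_def)
        ultimately show ?thesis by blast
      qed
    qed
  qed
qed

section \<open>The matrix exponential\<close>

definition mat_bound :: "real^'n^'n \<Rightarrow> real" where
  "mat_bound A = (\<Sum>i\<in>UNIV. \<Sum>j\<in>UNIV. \<bar>A $ i $ j\<bar>)"

text \<open>A crude exponential bound; it only has to make the entries of the exponential everywhere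
  convergent power series, so that they can be differentiated term by term.\<close>

lemma matpow_entry_le: "\<bar>matpow A k $ i $ j\<bar> \<le> mat_bound A ^ k"
proof (induction k arbitrary: i j)
  case 0
  then show ?case by (simp add: mat_def)
next
  case (Suc k)
  have "\<bar>matpow A (Suc k) $ i $ j\<bar> \<le> (\<Sum>l\<in>UNIV. \<bar>A $ i $ l\<bar> * \<bar>matpow A k $ l $ j\<bar>)"
    by (simp add: matrix_matrix_mult_def flip: abs_mult)
  also have "\<dots> \<le> (\<Sum>l\<in>UNIV. \<bar>A $ i $ l\<bar> * mat_bound A ^ k)"
    by (intro sum_mono mult_left_mono Suc) auto
  also have "\<dots> = (\<Sum>l\<in>UNIV. \<bar>A $ i $ l\<bar>) * mat_bound A ^ k"
    by (simp add: sum_distrib_right)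
  also have "\<dots> \<le> mat_bound A * mat_bound A ^ k"
    unfolding mat_bound_def
    by (intro mult_right_mono zero_le_power sum_nonneg
        member_le_sum[where f = "\<lambda>i. \<Sum>j\<in>UNIV. \<bar>A $ i $ j\<bar>"]) auto
  finally show ?case by simp
qed

lemma summable_matpow_entry: "summable (\<lambda>k. matpow A k $ i $ j / fact k * z ^ k)"
proof (rule summable_comparison_test')
  show "summable (\<lambda>k. (mat_bound A * \<bar>z\<bar>) ^ k /\<^sub>R fact k)"
    by (rule summable_exp_generic)
  show "norm (matpow A k $ i $ j / fact k * z ^ k) \<le> (mat_bound A * \<bar>z\<bar>) ^ k /\<^sub>R fact k" for k
    using mult_right_mono[OF matpow_entry_le[of A k i j], of "\<bar>z\<bar> ^ k / fact k"]
    by (simp add: abs_mult power_abs power_mult_distrib field_simps)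
qed

lemma matpow_scaleR:
  fixes A :: "real^'n^'n"
  shows "matpow (z *\<^sub>R A) k = z ^ k *\<^sub>R matpow A k"
proof (induction k)
  case (Suc k)
  have "(z *\<^sub>R A) ** (c *\<^sub>R M) = (z * c) *\<^sub>R (A ** M)" for c and M :: "real^'n^'n"
    by (simp add: vec_eq_iff matrix_matrix_mult_def sum_distrib_left mult.assoc mult.left_commute)
  then show ?case using Suc by simp
qed simp

lemma matpow_commute: "A ** matpow A k = matpow A k ** A"
proof (induction k)
  case (Suc k)
  then show ?case by (simp add: matrix_mul_assoc)
qed simp

lemma mexp_sums: "(\<lambda>k. matpow (z *\<^sub>R A) k /\<^sub>R fact k) sums mexp (z *\<^sub>R A)"
proof -
  have "(\<lambda>k. matpow (z *\<^sub>R A) k /\<^sub>R fact k) sums (\<chi> i j. \<Sum>k. matpow A k $ i $ j / fact k * z ^ k)"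
    unfolding sums_def
  proof (intro vec_tendstoI)
    fix i j
    show "(\<lambda>n. (\<Sum>k<n. matpow (z *\<^sub>R A) k /\<^sub>R fact k) $ i $ j) \<longlonglongrightarrow>
      (\<chi> i j. \<Sum>k. matpow A k $ i $ j / fact k * z ^ k) $ i $ j"
      using summable_sums[OF summable_matpow_entry[of A i j z]]
      by (simp add: sums_def matpow_scaleR field_simps)
  qed
  then show ?thesis
    unfolding mexp_def by (rule summable_sums[OF sums_summable])
qed

lemma mexp_entry_sums:
  "(\<lambda>k. matpow A k $ i $ j / fact k * z ^ k) sums (mexp (z *\<^sub>R A) $ i $ j)"
proof -
  have "(\<lambda>k. (matpow (z *\<^sub>R A) k /\<^sub>R fact k) $ i $ j) sums (mexp (z *\<^sub>R A) $ i $ j)"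
    by (intro bounded_linear.sums[OF bounded_linear_vec_nth] mexp_sums)
  then show ?thesis by (simp add: matpow_scaleR field_simps)
qed

lemma mexp_entry: "mexp (z *\<^sub>R A) $ i $ j = (\<Sum>k. matpow A k $ i $ j / fact k * z ^ k)"
  by (rule sums_unique[OF mexp_entry_sums])

lemma mult_mexp_entry_sums:
  "(\<lambda>k. (A ** matpow A k) $ i $ j / fact k * z ^ k) sums ((A ** mexp (z *\<^sub>R A)) $ i $ j)"
proof -
  have "(\<lambda>k. \<Sum>l\<in>UNIV. A $ i $ l * (matpow A k $ l $ j / fact k * z ^ k)) sums
      (\<Sum>l\<in>UNIV. A $ i $ l * mexp (z *\<^sub>R A) $ l $ j)"
    by (intro sums_sum sums_mult mexp_entry_sums)
  then show ?thesis
    by (simp add: matrix_matrix_mult_def sum_divide_distrib sum_distrib_right mult.assoc)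
qed

lemma mexp_commute: "A ** mexp (z *\<^sub>R A) = mexp (z *\<^sub>R A) ** A"
proof (intro vec_eq_iff[THEN iffD2] allI)
  fix i j
  have "(\<lambda>k. \<Sum>l\<in>UNIV. (matpow A k $ i $ l / fact k * z ^ k) * A $ l $ j) sums
      (\<Sum>l\<in>UNIV. mexp (z *\<^sub>R A) $ i $ l * A $ l $ j)"
    by (intro sums_sum sums_mult2 mexp_entry_sums)
  moreover have "(\<Sum>l\<in>UNIV. (matpow A k $ i $ l / fact k * z ^ k) * A $ l $ j) =
      (A ** matpow A k) $ i $ j / fact k * z ^ k" for k
    unfolding matpow_commute
    by (simp add: matrix_matrix_mult_def sum_divide_distrib sum_distrib_right mult.commute
        mult.left_commute sum_distrib_left)
  ultimately have "(\<lambda>k. (A ** matpow A k) $ i $ j / fact k * z ^ k) sums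
      ((mexp (z *\<^sub>R A) ** A) $ i $ j)"
    by (simp add: matrix_matrix_mult_def[of "mexp _"])
  then show "(A ** mexp (z *\<^sub>R A)) $ i $ j = (mexp (z *\<^sub>R A) ** A) $ i $ j"
    by (rule sums_unique2[OF mult_mexp_entry_sums])
qed

lemma mexp_entry_derivative:
  "((\<lambda>z. mexp (z *\<^sub>R A) $ i $ j) has_real_derivative (A ** mexp (z *\<^sub>R A)) $ i $ j) (at z)"
proof -
  let ?c = "\<lambda>k. matpow A k $ i $ j / fact k"
  have diffs: "diffs ?c k = (A ** matpow A k) $ i $ j / fact k" for k
    by (simp add: diffs_def field_simps del: of_nat_Suc)
  have "((\<lambda>z. \<Sum>k. ?c k * z ^ k) has_real_derivative (\<Sum>k. diffs ?c k * z ^ k)) (at z)"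
    by (intro termdiffs_strong_converges_everywhere sums_summable[OF mexp_entry_sums])
  also have "(\<Sum>k. diffs ?c k * z ^ k) = (A ** mexp (z *\<^sub>R A)) $ i $ j"
    unfolding diffs by (rule sums_unique[OF mult_mexp_entry_sums, symmetric])
  finally show ?thesis by (simp add: mexp_entry)
qed

lemma mexp_0: "mexp (0 :: real^'n^'n) = mat 1"
proof (intro vec_eq_iff[THEN iffD2] allI)
  fix i j
  show "mexp (0 :: real^'n^'n) $ i $ j = mat 1 $ i $ j"
    using mexp_entry[of 0 "0 :: real^'n^'n" i j] unfolding powser_zero by simp
qed

text \<open>The derivative of \<open>e^{z A} e^{- z A}\<close> is \<open>A e^{z A} e^{- z A} - e^{z A} A e^{- z A}\<close>, which
  vanishes because \<open>A\<close> commutes with \<open>e^{z A}\<close>.\<close>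

lemma mexp_inverse:
  fixes A :: "real^'n^'n"
  shows "mexp (z *\<^sub>R A) ** mexp (- z *\<^sub>R A) = mat 1"
proof (intro vec_eq_iff[THEN iffD2] allI)
  fix i j
  let ?M = "\<lambda>z. mexp (z *\<^sub>R A)"
  let ?g = "\<lambda>z. (?M z ** ?M (- z)) $ i $ j"
  have "(?g has_real_derivative 0) (at z)" for z
  proof -
    have minus: "((\<lambda>z. ?M (- z) $ l $ j) has_real_derivative - (A ** ?M (- z)) $ l $ j) (at z)" for l
    proof -
      have "(uminus has_real_derivative - 1) (at z)" by (auto intro!: derivative_eq_intros)
      from DERIV_chain2[where f = "\<lambda>z. ?M z $ l $ j", OF mexp_entry_derivative this]
      show ?thesis by simp
    qed
    have "((\<lambda>z. \<Sum>l\<in>UNIV. ?M z $ i $ l * ?M (- z) $ l $ j) has_real_derivative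
        (\<Sum>l\<in>UNIV. (A ** ?M z) $ i $ l * ?M (- z) $ l $ j
          + - (A ** ?M (- z)) $ l $ j * ?M z $ i $ l)) (at z)"
      by (intro DERIV_sum DERIV_mult mexp_entry_derivative minus)
    moreover have "?g = (\<lambda>z. \<Sum>l\<in>UNIV. ?M z $ i $ l * ?M (- z) $ l $ j)"
      by (simp add: matrix_matrix_mult_def)
    moreover have "(\<Sum>l\<in>UNIV. B $ i $ l * C $ l $ j + - D $ l $ j * E $ i $ l) =
        (B ** C) $ i $ j - (E ** D) $ i $ j" for B C D E :: "real^'n^'n"
      by (simp add: matrix_matrix_mult_def sum_subtractf mult.commute)
    ultimately have "(?g has_real_derivative
        ((A ** ?M z) ** ?M (- z)) $ i $ j - (?M z ** (A ** ?M (- z))) $ i $ j) (at z)"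
      by simp
    moreover have "(A ** ?M z) ** ?M (- z) = ?M z ** (A ** ?M (- z))"
      by (simp only: mexp_commute[of A z] matrix_mul_assoc)
    ultimately show ?thesis by simp
  qed
  then have "?g z = ?g 0" by (intro DERIV_isconst_all) blast
  then show "(?M z ** ?M (- z)) $ i $ j = mat 1 $ i $ j"
    by (simp add: mexp_0)
qed

lemma mexp_orbit_derivative:
  fixes A :: "real^'n^'n"
  shows
  "((\<lambda>z. mexp (z *\<^sub>R A) *v x) has_vector_derivative A *v (mexp (z *\<^sub>R A) *v x)) (at z)"
proof -
  have "((\<lambda>z. mexp (z *\<^sub>R A) *v x) has_vector_derivative (\<chi> i. (A *v (mexp (z *\<^sub>R A) *v x)) $ i)) (at z)"
    unfolding has_vector_derivative_def
  proof (subst has_derivative_componentwise_within, intro ballI)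
    fix b :: "real^'n" assume "b \<in> Basis"
    then obtain i where b: "b = axis i 1" by (auto simp: Basis_vec_def)
    have "((\<lambda>z. (mexp (z *\<^sub>R A) *v x) $ i) has_real_derivative ((A ** mexp (z *\<^sub>R A)) *v x) $ i) (at z)"
      unfolding matrix_vector_mult_def vec_lambda_beta
      by (intro DERIV_sum DERIV_cmult_right mexp_entry_derivative)
    then show "((\<lambda>z. (mexp (z *\<^sub>R A) *v x) \<bullet> b) has_derivative
        (\<lambda>h. h *\<^sub>R (\<chi> i. (A *v (mexp (z *\<^sub>R A) *v x)) $ i) \<bullet> b)) (at z)"
      by (simp add: b inner_axis matrix_vector_mul_assoc has_field_derivative_def mult_commute_abs)
  qed
  then show ?thesis by simp
qed

text \<open>The partial sums of the exponential series stay in \<open>E\<close>, and a finite-dimensional subspace is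
  closed.\<close>

lemma mexp_preserves_invariant:
  fixes A :: "real^'n^'n"
  assumes E: "subspace E" "(*v) A ` E \<subseteq> E" and x: "x \<in> E"
  shows "mexp (z *\<^sub>R A) *v x \<in> E"
proof -
  have pow: "matpow A k *v x \<in> E" for k
    using E x by (induction k) (auto simp: matrix_vector_mul_assoc[symmetric])
  have "bounded_linear (\<lambda>M :: real^'n^'n. M *v x)"
    by (auto intro!: linear_conv_bounded_linear[THEN iffD1] linearI
        simp: matrix_vector_mult_add_rdistrib scaleR_matrix_vector_assoc)
  then have lim: "(\<lambda>k. (matpow (z *\<^sub>R A) k /\<^sub>R fact k) *v x) sums (mexp (z *\<^sub>R A) *v x)"
    by (rule bounded_linear.sums[OF _ mexp_sums])
  have "(matpow (z *\<^sub>R A) k /\<^sub>R fact k) *v x \<in> E" for k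
    using pow E(1) by (simp add: matpow_scaleR subspace_scale flip: scaleR_matrix_vector_assoc)
  then have "(\<Sum>k<n. (matpow (z *\<^sub>R A) k /\<^sub>R fact k) *v x) \<in> E" for n
    by (rule subspace_sum[OF E(1)])
  then show ?thesis
    by (rule closed_sequentially[OF closed_subspace[OF E(1)] _ lim[unfolded sums_def]])
qed

section \<open>The flow solves the Young equation\<close>

text \<open>Each interval of a fine division has length at most \<open>2 d\<close>, which bounds the surplus power
  \<open>\<gamma>\<close>; the remaining first powers of the lengths add up to \<open>t\<close>.\<close>

lemma tagged_division_power_sum_le:
  fixes t :: real
  assumes "0 \<le> t" and p: "p tagged_division_of {0..t}" and fine: "(\<lambda>x. ball x d) fine p"
    and "0 \<le> \<gamma>"
  shows "(\<Sum>(x, K)\<in>p. (Sup K - Inf K) powr (1 + \<gamma>)) \<le> t * (2 * d) powr \<gamma>"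
proof -
  have "(\<Sum>(x, K)\<in>p. (Sup K - Inf K) powr (1 + \<gamma>)) \<le>
      (\<Sum>(x, K)\<in>p. (Sup K - Inf K) * (2 * d) powr \<gamma>)"
  proof (intro sum_mono, clarify)
    fix x K assume xK: "(x, K) \<in> p"
    then obtain u v where K: "K = {u..v}" "x \<in> {u..v}"
      using p tagged_division_ofD(2,4)[OF p xK] by (metis box_real(2))
    then have "u \<le> v" by auto
    then have "u \<in> ball x d" "v \<in> ball x d" using fine xK K by (auto simp: fine_def subset_iff)
    then have "v - u \<le> 2 * d" by (auto simp: dist_real_def)
    moreover have "(v - u) powr (1 + \<gamma>) = (v - u) * (v - u) powr \<gamma>"
      using \<open>u \<le> v\<close> by (simp add: powr_add)
    ultimately show "(Sup K - Inf K) powr (1 + \<gamma>) \<le> (Sup K - Inf K) * (2 * d) powr \<gamma>"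
      using \<open>u \<le> v\<close> \<open>0 \<le> \<gamma>\<close> by (auto simp: K intro!: mult_left_mono powr_mono2)
  qed
  also have "\<dots> = (\<Sum>(x, K)\<in>p. Sup K - Inf K) * (2 * d) powr \<gamma>"
    by (simp add: sum_distrib_right case_prod_unfold)
  also have "\<dots> = t * (2 * d) powr \<gamma>"
    using additive_tagged_division_1[OF assms(1) p, of "\<lambda>x. x"] by simp
  finally show ?thesis .
qed

text \<open>The Young integral obeys the classical chain rule \<open>dG(Z) = G'(Z) dZ\<close>. On a piece of length
  \<open>l\<close> the increment of \<open>Z\<close> is \<open>O(l^\<alpha>)\<close>, so a first-order Taylor expansion of
  \<open>G\<close> around the value of \<open>Z\<close> at the tag has an error \<open>O(l^{2 \<alpha>})\<close>. The increments of
  \<open>G(Z)\<close> telescope, and the errors sum to \<open>O(mesh^{2 \<alpha> - 1})\<close>, which tends to 0 exactly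
  because \<open>\<alpha> > 1/2\<close>.\<close>

lemma has_young_integral_chain_rule:
  fixes G G' :: "real \<Rightarrow> 'a::real_normed_vector"
  assumes "0 \<le> t" and \<alpha>: "1/2 < \<alpha>" and Z: "holder_on \<alpha> {0..t} Z"
    and G: "\<And>z. (G has_vector_derivative G' z) (at z)"
    and lip: "\<And>z w. \<bar>z - Z 0\<bar> \<le> R \<Longrightarrow> \<bar>w - Z 0\<bar> \<le> R \<Longrightarrow> norm (G' z - G' w) \<le> M * \<bar>z - w\<bar>"
    and R: "\<And>s. s \<in> {0..t} \<Longrightarrow> \<bar>Z s - Z 0\<bar> \<le> R"
  shows "has_young_integral (\<lambda>s. G' (Z s)) Z 0 t (G (Z t) - G (Z 0))"
proof -
  obtain C0 where C0: "\<And>s u. s \<in> {0..t} \<Longrightarrow> u \<in> {0..t} \<Longrightarrow> \<bar>Z s - Z u\<bar> \<le> C0 * \<bar>s - u\<bar> powr \<alpha>"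
    using Z unfolding holder_on_def dist_real_def by blast
  (* The Hoelder constant may be negative when the interval is a single point. *)
  define C where "C = max C0 0"
  have C: "\<bar>Z s - Z u\<bar> \<le> C * r powr \<alpha>" if "s \<in> {0..t}" "u \<in> {0..t}" "\<bar>s - u\<bar> \<le> r" for s u r
  proof -
    have "C0 * \<bar>s - u\<bar> powr \<alpha> \<le> C * \<bar>s - u\<bar> powr \<alpha>" by (simp add: C_def mult_right_mono)
    also have "\<dots> \<le> C * r powr \<alpha>" using that \<alpha> by (intro mult_left_mono powr_mono2) (auto simp: C_def)
    finally show ?thesis using C0[OF that(1,2)] by simp
  qed
  have "C \<ge> 0" by (simp add: C_def)
  define L where "L = \<bar>M\<bar> * C\<^sup>2"
  have local: "norm (G (Z v) - G (Z u) - (Z v - Z u) *\<^sub>R G' (Z x)) \<le> L * (v - u) powr (2 * \<alpha>)"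
    if "0 \<le> u" "u \<le> x" "x \<le> v" "v \<le> t" for u x v
  proof -
    define h where "h = C * (v - u) powr \<alpha>"
    have near: "\<bar>Z u - Z x\<bar> \<le> h" "\<bar>Z v - Z x\<bar> \<le> h" "\<bar>Z v - Z u\<bar> \<le> h"
      unfolding h_def using that by (auto intro!: C)
    have inR: "\<bar>z - Z 0\<bar> \<le> R" if "z \<in> closed_segment (Z u) (Z v) \<union> {Z x}" for z
      using that R[of u] R[of v] R[of x] \<open>0 \<le> u\<close> \<open>u \<le> x\<close> \<open>x \<le> v\<close> \<open>v \<le> t\<close>
      by (auto simp: closed_segment_eq_real_ivl split: if_splits)
    have "norm (G (Z v) - G (Z u) - (Z v - Z u) *\<^sub>R G' (Z x)) \<le> norm (Z v - Z u) * (\<bar>M\<bar> * h)"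
    proof (rule vector_differentiable_bound_linearization)
      let ?S = "closed_segment (Z u) (Z v) \<union> {Z x}"
      show "(G has_vector_derivative G' z) (at z within ?S)" for z
        by (rule has_vector_derivative_at_within[OF G])
      show "norm (G' z - G' (Z x)) \<le> \<bar>M\<bar> * h" if "z \<in> ?S" for z
      proof -
        have "\<bar>z - Z x\<bar> \<le> h"
          using that near by (auto simp: closed_segment_eq_real_ivl split: if_splits)
        then have "\<bar>M\<bar> * \<bar>z - Z x\<bar> \<le> \<bar>M\<bar> * h" by (intro mult_left_mono) auto
        moreover have "M * \<bar>z - Z x\<bar> \<le> \<bar>M\<bar> * \<bar>z - Z x\<bar>" by (intro mult_right_mono) auto
        ultimately show ?thesis using lip[OF inR[OF that] inR[of "Z x"]] by auto
      qed
    qed auto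
    also have "\<dots> \<le> h * (\<bar>M\<bar> * h)"
      using near by (intro mult_right_mono mult_nonneg_nonneg) auto
    also have "\<dots> = L * (v - u) powr (2 * \<alpha>)"
    proof -
      have "(v - u) powr (2 * \<alpha>) = ((v - u) powr \<alpha>) * ((v - u) powr \<alpha>)"
        unfolding mult_2 by (rule powr_add)
      then show ?thesis by (simp add: h_def L_def power2_eq_square)
    qed
    finally show ?thesis .
  qed
  show ?thesis
    unfolding has_young_integral_def
  proof (intro allI impI)
    fix \<epsilon> :: real assume "\<epsilon> > 0"
    define \<gamma> where "\<gamma> = 2 * \<alpha> - 1"
    have "\<gamma> > 0" using \<alpha> by (simp add: \<gamma>_def)
    (* The mesh d makes (2 d) powr \<gamma> equal to q; the summand 1 keeps the denominator
       positive when L or t vanishes. *)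
    define q where "q = \<epsilon> / (L * t + 1)"
    have Lt: "L * t \<ge> 0" using \<open>0 \<le> t\<close> by (simp add: L_def)
    then have "q > 0" using \<open>\<epsilon> > 0\<close> by (simp add: q_def)
    define d where "d = q powr (1 / \<gamma>) / 2"
    have "(2 * d) powr \<gamma> = q" using \<open>q > 0\<close> \<open>\<gamma> > 0\<close> by (simp add: d_def powr_powr)
    have bound: "norm ((\<Sum>(x, K)\<in>p. (Z (Sup K) - Z (Inf K)) *\<^sub>R G' (Z x)) - (G (Z t) - G (Z 0))) < \<epsilon>"
      if p: "p tagged_division_of {0..t}" and fine: "(\<lambda>x. ball x d) fine p" for p
    proof -
      have "(\<Sum>(x, K)\<in>p. G (Z (Sup K)) - G (Z (Inf K))) = G (Z t) - G (Z 0)"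
        by (rule additive_tagged_division_1[OF \<open>0 \<le> t\<close> p])
      then have "norm ((\<Sum>(x, K)\<in>p. (Z (Sup K) - Z (Inf K)) *\<^sub>R G' (Z x)) - (G (Z t) - G (Z 0)))
        = norm (\<Sum>(x, K)\<in>p. G (Z (Sup K)) - G (Z (Inf K)) - (Z (Sup K) - Z (Inf K)) *\<^sub>R G' (Z x))"
        by (simp add: case_prod_unfold sum_subtractf norm_minus_commute)
      also have "\<dots> \<le> (\<Sum>(x, K)\<in>p. L * (Sup K - Inf K) powr (1 + \<gamma>))"
      proof (intro sum_norm_le, clarify)
        fix x K assume xK: "(x, K) \<in> p"
        then obtain u v where K: "K = {u..v}" "x \<in> {u..v}"
          using p tagged_division_ofD(2,4)[OF p xK] by (metis box_real(2))
        moreover have "K \<subseteq> {0..t}" using tagged_division_ofD(3)[OF p xK] .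
        ultimately show "norm (G (Z (Sup K)) - G (Z (Inf K)) - (Z (Sup K) - Z (Inf K)) *\<^sub>R G' (Z x))
            \<le> L * (Sup K - Inf K) powr (1 + \<gamma>)"
          using local[of u x v] by (auto simp: \<gamma>_def)
      qed
      also have "\<dots> = L * (\<Sum>(x, K)\<in>p. (Sup K - Inf K) powr (1 + \<gamma>))"
        by (simp add: sum_distrib_left case_prod_unfold)
      also have "\<dots> \<le> L * (t * (2 * d) powr \<gamma>)"
        using \<open>\<gamma> > 0\<close>
        by (intro mult_left_mono tagged_division_power_sum_le[OF \<open>0 \<le> t\<close> p fine]) (auto simp: L_def)
      also have "\<dots> = (L * t) * q" using \<open>(2 * d) powr \<gamma> = q\<close> by simp
      also have "\<dots> < (L * t + 1) * q" using \<open>q > 0\<close> by simp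
      also have "\<dots> = \<epsilon>" using Lt by (simp add: q_def)
      finally show ?thesis .
    qed
    have "d > 0" using \<open>q > 0\<close> by (simp add: d_def)
    with bound show "\<exists>\<delta>>0. \<forall>p. p tagged_division_of {0..t} \<and> (\<lambda>x. ball x \<delta>) fine p \<longrightarrow>
        norm ((\<Sum>(x, K)\<in>p. (Z (Sup K) - Z (Inf K)) *\<^sub>R G' (Z x)) - (G (Z t) - G (Z 0))) < \<epsilon>"
      by blast
  qed
qed

lemma mexp_orbit_lipschitz:
  fixes A :: "real^'n^'n"
  obtains M where "M \<ge> 0" "\<And>z w. \<bar>z\<bar> \<le> R \<Longrightarrow> \<bar>w\<bar> \<le> R \<Longrightarrow>
    norm (mexp (z *\<^sub>R A) *v x - mexp (w *\<^sub>R A) *v x) \<le> M * \<bar>z - w\<bar>"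
proof -
  let ?y = "\<lambda>z. mexp (z *\<^sub>R A) *v x"
  have "isCont ?y z" for z
    using mexp_orbit_derivative by (rule has_vector_derivative_continuous)
  then have "continuous_on {-R..R} ?y"
    by (simp add: continuous_at_imp_continuous_on)
  then have "continuous_on {-R..R} (\<lambda>z. A *v ?y z)"
    by (rule bounded_linear.continuous_on[OF matrix_vector_mul_bounded_linear])
  then have "bounded ((\<lambda>z. A *v ?y z) ` {-R..R})"
    by (rule compact_imp_bounded[OF compact_continuous_image[OF _ compact_Icc]])
  then obtain M where M: "M > 0" "\<And>z. z \<in> {-R..R} \<Longrightarrow> norm (A *v ?y z) \<le> M"
    by (auto simp: bounded_pos)
  have "norm (?y z - ?y w) \<le> M * \<bar>z - w\<bar>" if "\<bar>z\<bar> \<le> R" "\<bar>w\<bar> \<le> R" for z w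
  proof -
    have "norm (?y z - ?y w) \<le> M * norm (z - w)"
    proof (rule differentiable_bound)
      show "(?y has_derivative (\<lambda>h. h *\<^sub>R (A *v ?y z))) (at z within {-R..R})" for z
        using has_derivative_at_withinI[OF mexp_orbit_derivative[unfolded has_vector_derivative_def]] .
      show "onorm (\<lambda>h. h *\<^sub>R (A *v ?y z)) \<le> M" if "z \<in> {-R..R}" for z
      proof (rule onorm_le)
        show "norm (h *\<^sub>R (A *v ?y z)) \<le> M * norm h" for h
          using mult_right_mono[OF M(2)[OF that] abs_ge_zero[of h]] by (simp add: mult.commute)
      qed
    qed (use that in auto)
    then show ?thesis by simp
  qed
  then show thesis using M(1) that[of M] by auto
qed

lemma linear_young_flow_solves:
  fixes A :: "real^'n^'n"
  assumes "1/2 < \<alpha>" and Z: "holder_on \<alpha> {0..T} Z"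
  shows "linear_young_solution A \<alpha> T Z x (\<lambda>t. linear_young_flow A Z t x)"
proof -
  let ?y = "\<lambda>z. mexp ((z - Z 0) *\<^sub>R A) *v x"
  obtain C where C: "\<And>s u. s \<in> {0..T} \<Longrightarrow> u \<in> {0..T} \<Longrightarrow> \<bar>Z s - Z u\<bar> \<le> C * \<bar>s - u\<bar> powr \<alpha>"
    using Z unfolding holder_on_def dist_real_def by blast
  define R where "R = \<bar>C\<bar> * T powr \<alpha>"
  have R: "\<bar>Z s - Z 0\<bar> \<le> R" if "s \<in> {0..T}" for s
  proof -
    have "\<bar>Z s - Z 0\<bar> \<le> C * s powr \<alpha>" using C[of s 0] that by auto
    also have "\<dots> \<le> \<bar>C\<bar> * s powr \<alpha>" by (intro mult_right_mono) auto
    also have "\<dots> \<le> R" unfolding R_def using that assms(1) by (intro mult_left_mono powr_mono2) auto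
    finally show ?thesis .
  qed
  obtain M where M: "M \<ge> 0" and lip: "\<And>z w. \<bar>z\<bar> \<le> R \<Longrightarrow> \<bar>w\<bar> \<le> R \<Longrightarrow>
      norm (mexp (z *\<^sub>R A) *v x - mexp (w *\<^sub>R A) *v x) \<le> M * \<bar>z - w\<bar>"
    using mexp_orbit_lipschitz[of R A x] by blast
  have "holder_on \<alpha> {0..T} (\<lambda>t. ?y (Z t))"
    unfolding holder_on_def
  proof (intro exI[of _ "M * C"] ballI)
    fix s u assume su: "s \<in> {0..T}" "u \<in> {0..T}"
    have "dist (?y (Z s)) (?y (Z u)) \<le> M * \<bar>Z s - Z u\<bar>"
      using lip[OF R[OF su(1)] R[OF su(2)]] by (simp add: dist_norm)
    also have "\<dots> \<le> M * (C * \<bar>s - u\<bar> powr \<alpha>)" using M C[OF su] by (rule mult_left_mono[rotated])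
    finally show "dist (?y (Z s)) (?y (Z u)) \<le> M * C * \<bar>s - u\<bar> powr \<alpha>" by (simp add: mult.assoc)
  qed
  moreover have "has_young_integral (\<lambda>s. A *v ?y (Z s)) Z 0 t (?y (Z t) - x)" if t: "t \<in> {0..T}" for t
  proof -
    have "has_young_integral (\<lambda>s. A *v ?y (Z s)) Z 0 t (?y (Z t) - ?y (Z 0))"
    proof (rule has_young_integral_chain_rule[where R = R and M = "onorm ((*v) A) * M"])
      show "holder_on \<alpha> {0..t} Z" using Z t unfolding holder_on_def by fastforce
      show "(?y has_vector_derivative A *v ?y z) (at z)" for z
      proof -
        have "((\<lambda>z. z - Z 0) has_vector_derivative 1) (at z)"
          by (auto intro!: derivative_eq_intros)
        from vector_diff_chain_at[OF this mexp_orbit_derivative[of A x]]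
        show ?thesis by (simp add: o_def)
      qed
      show "norm (A *v ?y z - A *v ?y w) \<le> onorm ((*v) A) * M * \<bar>z - w\<bar>"
        if "\<bar>z - Z 0\<bar> \<le> R" "\<bar>w - Z 0\<bar> \<le> R" for z w
      proof -
        have "norm (A *v (?y z - ?y w)) \<le> onorm ((*v) A) * norm (?y z - ?y w)"
          by (rule onorm[OF matrix_vector_mul_bounded_linear])
        also have "\<dots> \<le> onorm ((*v) A) * (M * \<bar>z - w\<bar>)"
          using lip[OF that]
          by (simp add: mult_left_mono onorm_pos_le[OF matrix_vector_mul_bounded_linear])
        finally show ?thesis by (simp add: matrix_vector_mult_diff_distrib mult.assoc)
      qed
      show "0 \<le> t" using t by simp
      show "1/2 < \<alpha>" by fact
      show "\<bar>Z s - Z 0\<bar> \<le> R" if "s \<in> {0..t}" for s using R[of s] t that by simp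
    qed
    then show ?thesis by (simp add: mexp_0)
  qed
  ultimately show ?thesis
    by (simp add: linear_young_solution_def linear_young_flow_def mexp_0)
qed

section \<open>Decomposing a linear isomorphism along two foliations\<close>

lemma Ck_const: "Ck k (\<lambda>x. c)"
proof (induction k arbitrary: c)
  case (Suc k)
  have "frechet_derivative (\<lambda>x::'a. c) (at x) = (\<lambda>h. 0)" for x and c :: 'b
    by (rule frechet_derivative_at[symmetric]) (rule has_derivative_const)
  then show ?case using Suc by simp
qed simp

lemma smooth_linear:
  assumes "linear f"
  shows "smooth f"
  unfolding smooth_def
proof
  fix k
  show "Ck k f"
  proof (cases k)
    case 0
    then show ?thesis using assms by (simp add: linear_continuous_on linear_conv_bounded_linear)
  next
    case (Suc m)
    have d: "(f has_derivative f) (at x)" for x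
      by (rule linear_imp_has_derivative[OF assms])
    then have "frechet_derivative f (at x) = f" for x
      by (rule frechet_derivative_at[symmetric])
    then show ?thesis using Suc d Ck_const by (auto simp: differentiable_def)
  qed
qed

lemma diffeomorphism_linear:
  fixes f :: "'a::euclidean_space \<Rightarrow> 'a"
  assumes "linear f" "bij f"
  shows "diffeomorphism f"
  unfolding diffeomorphism_def
  using assms smooth_linear inj_linear_imp_inv_linear bij_is_inj by blast

text \<open>Here \<open>f\<close> moves each point within its leaf, so it maps a leaf into itself; that a leaf is also
  covered follows from bijectivity, as the preimage of a point lies in the leaf of that point.\<close>

lemma leaf_preserving_parallel:
  assumes "bij f" "subspace E" and "\<And>x. f x - x \<in> E"
  shows "leaf_preserving (parallel_foliation E) f"
  unfolding leaf_preserving_def parallel_foliation_def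
proof clarify
  fix x
  have leaf: "y \<in> (+) x ` E \<longleftrightarrow> y - x \<in> E" for y
    by (auto simp: image_iff intro: bexI[of _ "y - x"])
  show "f ` (+) x ` E = (+) x ` E"
  proof (intro subset_antisym subsetI)
    fix y assume "y \<in> f ` (+) x ` E"
    then obtain e where "y = f (x + e)" "e \<in> E" by auto
    then have "y - x = (f (x + e) - (x + e)) + e" by simp
    then show "y \<in> (+) x ` E"
      using leaf assms(3) \<open>e \<in> E\<close> subspace_add[OF assms(2)] by metis
  next
    fix y assume y: "y \<in> (+) x ` E"
    obtain w where w: "f w = y" using assms(1) by (metis bij_pointE)
    have "w - x = (y - x) - (f w - w)" by (simp add: w)
    then have "w \<in> (+) x ` E"
      using leaf assms(3) y subspace_diff[OF assms(2)] by metis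
    then show "y \<in> f ` (+) x ` E" using w by blast
  qed
qed

text \<open>Since \<open>E\<^sub>1 \<inter> E\<^sub>2 = {0}\<close>, the \<open>E\<^sub>2\<close>-component of a vector is unique, and a uniquely
  determined component depends linearly on the vector.\<close>

lemma linear_projection_exists:
  fixes E\<^sub>1 E\<^sub>2 :: "'a::euclidean_space set"
  assumes "complementary_subspaces E\<^sub>1 E\<^sub>2"
  obtains \<pi> where "linear \<pi>" "\<And>x. \<pi> x \<in> E\<^sub>2" "\<And>x. x - \<pi> x \<in> E\<^sub>1" "\<And>x. x \<in> E\<^sub>1 \<Longrightarrow> \<pi> x = 0"
proof -
  have s: "subspace E\<^sub>1" "subspace E\<^sub>2" and int: "E\<^sub>1 \<inter> E\<^sub>2 = {0}"
    using assms by (auto simp: complementary_subspaces_def)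
  have "\<exists>y. y \<in> E\<^sub>2 \<and> x - y \<in> E\<^sub>1" for x
  proof -
    have "x \<in> {x + y |x y. x \<in> E\<^sub>1 \<and> y \<in> E\<^sub>2}"
      using assms by (simp add: complementary_subspaces_def)
    then obtain a b where "x = a + b" "a \<in> E\<^sub>1" "b \<in> E\<^sub>2" by blast
    then show ?thesis by (intro exI[of _ b]) simp
  qed
  then obtain \<pi> where p: "\<And>x. \<pi> x \<in> E\<^sub>2" "\<And>x. x - \<pi> x \<in> E\<^sub>1" by metis
  have uniq: "\<pi> x = y" if "y \<in> E\<^sub>2" "x - y \<in> E\<^sub>1" for x y
  proof -
    have "(x - y) - (x - \<pi> x) \<in> E\<^sub>1" by (intro subspace_diff s p that)
    moreover have "\<pi> x - y \<in> E\<^sub>2" by (intro subspace_diff s p that)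
    ultimately have "\<pi> x - y \<in> E\<^sub>1 \<inter> E\<^sub>2" by simp
    then show ?thesis unfolding int by simp
  qed
  have "linear \<pi>"
  proof
    fix x y c
    have "(x - \<pi> x) + (y - \<pi> y) \<in> E\<^sub>1" by (intro subspace_add s p)
    then show "\<pi> (x + y) = \<pi> x + \<pi> y"
      by (intro uniq subspace_add s p) (simp add: algebra_simps)
    have "c *\<^sub>R (x - \<pi> x) \<in> E\<^sub>1" by (intro subspace_scale s p)
    then show "\<pi> (c *\<^sub>R x) = c *\<^sub>R \<pi> x"
      by (intro uniq subspace_scale s p) (simp add: algebra_simps)
  qed
  moreover have "\<pi> x = 0" if "x \<in> E\<^sub>1" for x
    using that by (intro uniq) (simp_all add: subspace_0 s)
  ultimately show thesis using p that by blast
qed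

text \<open>Let \<open>\<pi>\<close> be the projection onto \<open>E\<^sub>2\<close> along \<open>E\<^sub>1\<close>. In an equation \<open>F = \<eta> \<circ> \<psi>\<close>
  the map \<open>\<eta>\<close> does not change the \<open>E\<^sub>2\<close>-component and \<open>\<psi>\<close> does not change the
  \<open>E\<^sub>1\<close>-component, which forces \<open>\<psi> x = (x - \<pi> x) + \<pi> (F x)\<close>. In block form
  \<open>\<psi>\<close> is the identity on \<open>E\<^sub>1\<close> and the lower diagonal block of \<open>F\<close> on \<open>E\<^sub>2\<close>. For an
  invariant \<open>E\<^sub>1\<close> the matrix of \<open>F\<close> is block triangular, so this block is invertible along with
  \<open>F\<close>. This invertibility is the only possible obstruction.\<close>

lemma foliation_decomposition_linear:
  fixes F :: "'a::euclidean_space \<Rightarrow> 'a"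
  assumes F: "linear F" "inj F" and E: "complementary_subspaces E\<^sub>1 E\<^sub>2" and inv: "F ` E\<^sub>1 \<subseteq> E\<^sub>1"
  shows "\<exists>\<eta> \<psi>. foliation_decomposition E\<^sub>1 E\<^sub>2 F \<eta> \<psi>"
proof -
  have s: "subspace E\<^sub>1" "subspace E\<^sub>2" and int: "E\<^sub>1 \<inter> E\<^sub>2 = {0}"
    using E by (auto simp: complementary_subspaces_def)
  obtain \<pi> where \<pi>: "linear \<pi>" "\<And>x. \<pi> x \<in> E\<^sub>2" "\<And>x. x - \<pi> x \<in> E\<^sub>1" "\<And>x. x \<in> E\<^sub>1 \<Longrightarrow> \<pi> x = 0"
    using linear_projection_exists[OF E] by blast
  (* Consequently, a point that F maps into E1 already lies in E1. *)
  have onto: "F ` E\<^sub>1 = E\<^sub>1"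
  proof (rule subspace_dim_equal[OF linear_subspace_image[OF F(1) s(1)] s(1) inv])
    show "dim E\<^sub>1 \<le> dim (F ` E\<^sub>1)"
      using dim_image_eq[OF F(1), of E\<^sub>1] F(2) by (simp add: inj_on_subset)
  qed
  define \<psi> where "\<psi> x = x - \<pi> x + \<pi> (F x)" for x
  have lin: "linear \<psi>"
    unfolding \<psi>_def
    by (intro linear_compose_add linear_compose_sub linear_id[unfolded id_def] \<pi>
        linear_compose[unfolded o_def, OF F(1) \<pi>(1)])
  have "x = 0" if "\<psi> x = 0" for x
  proof -
    have "x - \<pi> x = - \<pi> (F x)" using that by (simp add: \<psi>_def eq_neg_iff_add_eq_0)
    then have "x - \<pi> x \<in> E\<^sub>1 \<inter> E\<^sub>2" using \<pi>(2,3) s(2) by (metis IntI subspace_neg)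
    then have x: "x - \<pi> x = 0" unfolding int by simp
    then have "\<pi> (F x) = 0" using that by (simp add: \<psi>_def)
    then have "F x \<in> E\<^sub>1" using \<pi>(3)[of "F x"] by simp
    then have "x \<in> E\<^sub>1" using onto F(2) by (metis imageE injD)
    then show "x = 0" using x \<pi>(4) by simp
  qed
  then have "inj \<psi>" using lin by (simp add: linear_injective_0)
  then have bij: "bij \<psi>" using linear_injective_imp_surjective[OF lin] by (simp add: bij_def)
  have "bij F" using linear_injective_imp_surjective[OF F] F(2) by (simp add: bij_def)
  have "linear (inv \<psi>)" using inj_linear_imp_inv_linear[OF lin \<open>inj \<psi>\<close>] .
  define \<eta> where "\<eta> = F \<circ> inv \<psi>"
  have lin': "linear \<eta>" unfolding \<eta>_def by (rule linear_compose[OF \<open>linear (inv \<psi>)\<close> F(1)])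
  have bij': "bij \<eta>" unfolding \<eta>_def by (intro bij_comp bij_imp_bij_inv bij \<open>bij F\<close>)
  have "\<eta> y - y \<in> E\<^sub>1" for y
  proof -
    obtain x where x: "y = \<psi> x" using bij by (metis bij_pointE)
    have "\<eta> y - y = (F x - \<pi> (F x)) - (x - \<pi> x)"
      using \<open>inj \<psi>\<close> by (simp add: \<eta>_def x) (simp add: \<psi>_def)
    then show ?thesis using \<pi>(3) s(1) by (metis subspace_diff)
  qed
  then have "leaf_preserving (parallel_foliation E\<^sub>1) \<eta>"
    by (intro leaf_preserving_parallel bij' s)
  moreover have "\<psi> x - x \<in> E\<^sub>2" for x
  proof -
    have "\<psi> x - x = \<pi> (F x) - \<pi> x" by (simp add: \<psi>_def)
    then show ?thesis using \<pi>(2) s(2) by (metis subspace_diff)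
  qed
  then have "leaf_preserving (parallel_foliation E\<^sub>2) \<psi>"
    by (intro leaf_preserving_parallel bij s)
  moreover have "F = \<eta> \<circ> \<psi>"
    using \<open>inj \<psi>\<close> by (simp add: \<eta>_def fun_eq_iff)
  ultimately show ?thesis
    unfolding foliation_decomposition_def
    using diffeomorphism_linear[OF lin bij] diffeomorphism_linear[OF lin' bij'] by blast
qed

lemma complementary_orthogonal_comp:
  assumes "subspace E"
  shows "complementary_subspaces E (orthogonal_comp E)"
proof -
  have "{x + y |x y. x \<in> E \<and> y \<in> orthogonal_comp E} = E + orthogonal_comp E"
    by (auto simp: set_plus_def)
  then show ?thesis
    using assms by (simp add: complementary_subspaces_def subspace_orthogonal_comp
        orthogonal_Int_0 subspace_sum_orthogonal_comp)
qed

section \<open>Invariant subspaces and the number of real eigenvalues\<close>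

lemma poly_charpoly: "poly (charpoly A) x = det (mat x - A)"
proof -
  have of_int: "poly (of_int z) x = of_int z" for z :: int and x :: real
    by (metis of_int_poly poly_pCons poly_0 mult_zero_right add.right_neutral)
  have "poly ((if i = j then [:0, 1:] else 0) - [:A $ i $ j:]) x = (mat x - A) $ i $ j" for i j
    by (simp add: mat_def)
  then show ?thesis
    unfolding charpoly_def det_def
    by (simp add: poly_sum poly_prod of_int del: poly_diff)
qed

lemma degree_charpoly_le: "degree (charpoly (A :: real^'n^'n)) \<le> CARD('n)"
  unfolding charpoly_def det_def
proof (rule degree_sum_le)
  fix p :: "'n \<Rightarrow> 'n"
  let ?M = "(\<chi> i j. (if i = j then [:0, 1:] else 0) - [:A $ i $ j:]) :: real poly^'n^'n"
  have "degree (of_int (sign p) * (\<Prod>i\<in>UNIV. ?M $ i $ p i)) \<le>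
      degree (of_int (sign p) :: real poly) + degree (\<Prod>i\<in>UNIV. ?M $ i $ p i)"
    by (rule degree_mult_le)
  also have "degree (of_int (sign p) :: real poly) = 0"
    by (simp add: of_int_poly)
  also have "degree (\<Prod>i\<in>UNIV. ?M $ i $ p i) \<le> (\<Sum>i\<in>(UNIV :: 'n set). 1)"
    by (intro order.trans[OF degree_prod_sum_le] sum_mono) (auto intro!: degree_diff_le)
  finally show "degree (of_int (sign p) * (\<Prod>i\<in>UNIV. ?M $ i $ p i)) \<le> CARD('n)" by simp
qed (simp add: finite_permutations)

lemma real_eigenvalues_iff:
  fixes A :: "real^'n^'n"
  shows "\<mu> \<in> real_eigenvalues A \<longleftrightarrow> det (mat \<mu> - A) = 0"
proof -
  have mat: "mat \<mu> *v v = \<mu> *\<^sub>R v" for v :: "real^'n"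
    by (simp add: vec_eq_iff matrix_vector_mult_def mat_def if_distrib[of "\<lambda>c. c * _"] cong: if_cong)
  have "\<mu> \<in> real_eigenvalues A \<longleftrightarrow> (\<exists>v. (mat \<mu> - A) *v v = 0 \<and> v \<noteq> 0)"
    unfolding real_eigenvalues_def
    by (simp add: matrix_vector_mult_diff_rdistrib mat) metis
  also have "\<dots> \<longleftrightarrow> \<not> inj ((*v) (mat \<mu> - A))"
    using linear_injective_0[OF matrix_vector_mul_linear, of "mat \<mu> - A"] by blast
  also have "\<dots> \<longleftrightarrow> det (mat \<mu> - A) = 0"
    using det_nz_iff_inj[OF matrix_vector_mul_linear, of "mat \<mu> - A"]
    unfolding matrix_of_matrix_vector_mul by blast
  finally show ?thesis .
qed

text \<open>If the characteristic polynomial were zero, every real number would be an eigenvalue and the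
  defining sum of multiplicities would run over an infinite set, so its value would be 0. Otherwise the
  eigenvalues are the roots of a nonzero polynomial of degree at most \<open>CARD('n)\<close>.\<close>

lemma num_real_eigenvalues_le: "num_real_eigenvalues (A :: real^'n^'n) \<le> CARD('n)"
proof (cases "charpoly A = 0")
  case True
  then have "real_eigenvalues A = UNIV"
    using real_eigenvalues_iff[of _ A] poly_charpoly[of A] by auto
  then show ?thesis
    by (simp add: num_real_eigenvalues_def infinite_UNIV_char_0)
next
  case False
  have "real_eigenvalues A = {x. poly (charpoly A) x = 0}"
    using real_eigenvalues_iff[of _ A] poly_charpoly[of A] by auto
  then show ?thesis
    using sum_order_le_degree[OF False] degree_charpoly_le[of A]
    by (simp add: num_real_eigenvalues_def)
qed

text \<open>The number of real eigenvalues enters through two consequences: the dimension \<open>a + 2 b\<close>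
  does not exceed that of the whole space, and it is even if there is no real eigenvalue at all.\<close>

lemma invariant_subspace_of_dim:
  fixes A :: "real^'n^'n"
  assumes "a \<le> num_real_eigenvalues A" "b \<le> (CARD('n) - num_real_eigenvalues A) div 2"
  obtains E where "invariant ((*v) A) E" "dim E = a + 2 * b"
proof -
  let ?f = "(*v) A"
  have f: "linear ?f" and U: "invariant ?f UNIV" by (auto simp: invariant_def)
  have n: "a + 2 * b \<le> dim (UNIV :: (real^'n) set)"
    using assms num_real_eigenvalues_le[of A] by simp
  show thesis
  proof (cases "has_real_eigenvector ?f UNIV")
    case True
    then show thesis using invariant_subspace_any_dim[OF f U _ n] that by blast
  next
    case False
    then have "real_eigenvalues A = {}"
      by (auto simp: has_real_eigenvector_def real_eigenvalues_def)
    then have "a = 0" using assms(1) by (simp add: num_real_eigenvalues_def)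
    then show thesis using invariant_subspace_even_dim[OF f U False, of b] n that by auto
  qed
qed

section \<open>Decomposition of the flow\<close>

lemma linear_young_flow_decomposition:
  fixes A :: "real^'n^'n"
  assumes E: "invariant ((*v) A) E\<^sub>1" and c: "complementary_subspaces E\<^sub>1 E\<^sub>2"
  shows "\<exists>\<eta> \<psi>. foliation_decomposition E\<^sub>1 E\<^sub>2 (linear_young_flow A Z t) \<eta> \<psi>"
proof (rule foliation_decomposition_linear[OF _ _ c])
  let ?z = "Z t - Z 0"
  show "linear (linear_young_flow A Z t)"
    by (simp add: linear_young_flow_def)
  have "mexp (- ?z *\<^sub>R A) *v (mexp (?z *\<^sub>R A) *v x) = x" for x
    using mexp_inverse[of "- ?z" A] by (simp add: matrix_vector_mul_assoc)
  then show "inj (linear_young_flow A Z t)"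
    unfolding linear_young_flow_def by (metis injI)
  show "linear_young_flow A Z t ` E\<^sub>1 \<subseteq> E\<^sub>1"
    using E mexp_preserves_invariant[of E\<^sub>1 A]
    by (auto simp: linear_young_flow_def invariant_def)
qed

theorem proposition4p1:
  fixes A :: "real^'n^'n" and Z :: "real \<Rightarrow> real" and \<alpha> T :: real
  assumes "CARD('n) > 2"
    and "0 < T"
    and "1/2 < \<alpha>" and "\<alpha> \<le> 1"
    and "holder_on \<alpha> {0..T} Z"
  shows "(\<forall>x. linear_young_solution A \<alpha> T Z x (\<lambda>t. linear_young_flow A Z t x)) \<and>
    (\<forall>a\<in>{0..num_real_eigenvalues A}. \<forall>b\<in>{0..(CARD('n) - num_real_eigenvalues A) div 2}.
       \<exists>E\<^sub>1 E\<^sub>2 :: (real^'n) set.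
         complementary_subspaces E\<^sub>1 E\<^sub>2 \<and> dim E\<^sub>1 = a + 2 * b \<and>
         (\<exists>\<eta> \<psi> :: real \<Rightarrow> real^'n \<Rightarrow> real^'n. \<forall>t\<in>{0..T}.
            foliation_decomposition E\<^sub>1 E\<^sub>2 (linear_young_flow A Z t) (\<eta> t) (\<psi> t)))"
proof (intro conjI allI ballI)
  show "linear_young_solution A \<alpha> T Z x (\<lambda>t. linear_young_flow A Z t x)" for x
    by (rule linear_young_flow_solves) fact+
next
  fix a b
  assume "a \<in> {0..num_real_eigenvalues A}"
    and "b \<in> {0..(CARD('n) - num_real_eigenvalues A) div 2}"
  then obtain E where E: "invariant ((*v) A) E" "dim E = a + 2 * b"
    using invariant_subspace_of_dim[of a A b] by auto
  then have c: "complementary_subspaces E (orthogonal_comp E)"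
    by (simp add: invariant_def complementary_orthogonal_comp)
  have "\<exists>\<eta> \<psi>. foliation_decomposition E (orthogonal_comp E) (linear_young_flow A Z t) \<eta> \<psi>" for t
    by (rule linear_young_flow_decomposition[OF E(1) c])
  then have "\<exists>\<eta> \<psi>. \<forall>t\<in>{0..T}.
      foliation_decomposition E (orthogonal_comp E) (linear_young_flow A Z t) (\<eta> t) (\<psi> t)"
    by metis
  with E(2) c show "\<exists>E\<^sub>1 E\<^sub>2 :: (real^'n) set.
         complementary_subspaces E\<^sub>1 E\<^sub>2 \<and> dim E\<^sub>1 = a + 2 * b \<and>
         (\<exists>\<eta> \<psi> :: real \<Rightarrow> real^'n \<Rightarrow> real^'n. \<forall>t\<in>{0..T}.
            foliation_decomposition E\<^sub>1 E\<^sub>2 (linear_young_flow A Z t) (\<eta> t) (\<psi> t))"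
    by blast
qed

end
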